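(* The map $\|\cdot\|:\overline{\mathbb{IR}}\to\mathbb{R}$ given by $\|\mathcal{X}\|=l(\mathcal{X})+|c(\mathcal{X})|$ for any $\mathcal{X}\in\overline{\mathbb{IR}}$ is a norm on the real vector space $\overline{\mathbb{IR}}$.
   Context: $\mathbb{IR}$ denotes the set of closed bounded intervals $x=[x^-,x^+]$ of $\mathbb{R}$ with $x^-\le x^+$; a real $\alpha$ is identified with $[\alpha,\alpha]$ and $0=[0,0]$. Addition is $[x^-,x^+]+[y^-,y^+]=[x^-+y^-,x^++y^+]$. On $\mathbb{IR}\times\mathbb{IR}$ put $(x,y)\sim(z,t)$ iff $x+t=y+z$; the quotient is $\overline{\mathbb{IR}}$, with classes written $\overline{(x,y)}$. It is an abelian group for $\overline{(x,y)}+\overline{(z,t)}=\overline{(x+z,y+t)}$; the inverse of $\overline{(x,y)}$ is $\smallsetminus\overline{(x,y)}=\overline{(y,x)}$. Every element of $\overline{\mathbb{IR}}$ can be written as $\overline{(A,0)}$ or $\overline{(0,A)}$ with $A\in\mathbb{IR}$ (and both only when $A$ is degenerate: $\overline{(\alpha,0)}=\overline{(0,-\alpha)}$ for $\alpha\in\mathbb{R}$). It is a real vector space for: $\alpha\overline{(A,0)}=\overline{(\alpha A,0)}$, $\alpha\overline{(0,A)}=\overline{(0,\alpha A)}$ if $\alpha\ge0$; $\alpha\overline{(A,0)}=\overline{(0,-\alpha A)}$, $\alpha\overline{(0,A)}=\overline{(-\alpha A,0)}$ if $\alpha<0$, where $\gamma[a,b]=[\gamma a,\gamma b]$ for $\gamma\ge0$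 (so $-\alpha A$ means $|\alpha|A$). For $A=[a,b]\in\mathbb{IR}$, $l(A)=b-a$ and $c(A)=\frac{a+b}{2}$. For $\mathcal{X}=\overline{(A,0)}$ put $l(\mathcal{X})=l(A)$, $c(\mathcal{X})=c(A)$; for $\mathcal{X}=\overline{(0,A)}$ put $l(\mathcal{X})=l(A)$, $c(\mathcal{X})=-c(A)$. *)

theory Defs
  imports Complex_Main "HOL-Library.Interval"
begin

definition center :: "real interval \<Rightarrow> real"
  where "center A = (lower A + upper A) / 2"

text \<open>Only meaningful for \<open>0 \<le> \<gamma>\<close>; otherwise the argument of \<open>Interval\<close> need not be
  an ordered pair. The product \<open>\<alpha> A\<close> of the library's interval arithmetic would reverse the
  endpoints for negative \<open>\<alpha>\<close> and is not used here.\<close>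

definition dilate :: "real \<Rightarrow> real interval \<Rightarrow> real interval"
  where "dilate \<gamma> A = Interval (\<gamma> * lower A, \<gamma> * upper A)"

lemma lower_Interval: "a \<le> b \<Longrightarrow> lower (Interval (a, b)) = a"
  and upper_Interval: "a \<le> b \<Longrightarrow> upper (Interval (a, b)) = b"
  by (simp_all add: lower.rep_eq upper.rep_eq Interval_inverse)

lemma lower_dilate [simp]: "0 \<le> \<gamma> \<Longrightarrow> lower (dilate \<gamma> A) = \<gamma> * lower A"
  and upper_dilate [simp]: "0 \<le> \<gamma> \<Longrightarrow> upper (dilate \<gamma> A) = \<gamma> * upper A"
  by (simp_all add: dilate_def lower_Interval upper_Interval mult_left_mono)


definition diff_rel :: "real interval \<times> real interval \<Rightarrow> real interval \<times> real interval \<Rightarrow> bool"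
  where "diff_rel = (\<lambda>(x, y) (z, t). x + t = y + z)"

lemma diff_rel_iff:
  "diff_rel p q \<longleftrightarrow>
    lower (fst p) + lower (snd q) = lower (snd p) + lower (fst q) \<and>
    upper (fst p) + upper (snd q) = upper (snd p) + upper (fst q)"
  by (auto simp: diff_rel_def interval_eq_iff split: prod.splits)

quotient_type (overloaded) genint = "real interval \<times> real interval" / diff_rel
  by (rule equivpI) (auto simp: diff_rel_iff intro!: reflpI sympI transpI)

lift_definition cls :: "real interval \<Rightarrow> real interval \<Rightarrow> genint" is Pair .

lemma cls_eq_iff: "cls x y = cls z t \<longleftrightarrow> x + t = y + z"
  by transfer (simp add: diff_rel_def)

lemma cls_eq_iff_bounds:
  "cls x y = cls z t \<longleftrightarrow>
    lower x + lower t = lower y + lower z \<and> upper x + upper t = upper y + upper z"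
  by (simp add: cls_eq_iff interval_eq_iff)

lemma cls_exhaust: obtains x y where "X = cls x y"
proof -
  have "\<exists>x y. X = cls x y"
    by transfer (clarsimp simp: diff_rel_def, metis add.commute)
  then show thesis using that by blast
qed

lemma genint_cases:
  obtains (pos) A where "X = cls A 0" | (neg) A where "X = cls 0 A"
proof -
  obtain x y where X: "X = cls x y" by (rule cls_exhaust)
  show thesis
  proof (cases "width y \<le> width x")
    case True
    then have "lower x - lower y \<le> upper x - upper y" by (simp add: width_def)
    then have "X = cls (Interval (lower x - lower y, upper x - upper y)) 0"
      by (simp add: X cls_eq_iff_bounds lower_Interval upper_Interval)
    then show thesis by (rule pos)
  next
    case False
    then have "lower y - lower x \<le> upper y - upper x" by (simp add: width_def)
    then have "X = cls 0 (Interval (lower y - lower x, upper y - upper x))"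
      by (simp add: X cls_eq_iff_bounds lower_Interval upper_Interval)
    then show thesis by (rule neg)
  qed
qed


instantiation genint :: ab_group_add
begin

lift_definition zero_genint :: genint is "(0, 0)" .

lift_definition plus_genint :: "genint \<Rightarrow> genint \<Rightarrow> genint"
  is "\<lambda>(x, y) (z, t). (x + z, y + t)"
  by (auto simp: diff_rel_iff)

lift_definition uminus_genint :: "genint \<Rightarrow> genint"
  is "\<lambda>(x, y). (y, x)"
  by (auto simp: diff_rel_iff)

definition minus_genint :: "genint \<Rightarrow> genint \<Rightarrow> genint"
  where "X - Y = X + - Y" for X Y :: genint

instance
proof
  fix X Y Z :: genint
  show "X + Y + Z = X + (Y + Z)"
    by transfer (auto simp: diff_rel_iff)
  show "X + Y = Y + X"
    by transfer (auto simp: diff_rel_iff)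
  show "0 + X = X"
    by transfer (auto simp: diff_rel_iff)
  show "- X + X = 0"
    by transfer (auto simp: diff_rel_iff)
  show "X - Y = X + - Y"
    by (rule minus_genint_def)
qed

end

lemma zero_genint_cls: "0 = cls 0 0"
  by transfer (simp add: diff_rel_iff)

lemma plus_cls: "cls x y + cls z t = cls (x + z) (y + t)"
  by transfer (simp add: diff_rel_iff)

lemma uminus_cls: "- cls x y = cls y x"
  by transfer (simp add: diff_rel_iff)


text \<open>Scaling, length and center are given by cases on the representatives \<open>(A, 0)\<close> and
  \<open>(0, A)\<close>; the lemmas below show that the case distinction determines
  a unique value.\<close>

instantiation genint :: scaleR
begin

definition scaleR_genint :: "real \<Rightarrow> genint \<Rightarrow> genint" where
  "scaleR_genint \<alpha> X = (THE Y. \<exists>A.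
     (X = cls A 0 \<and> Y = (if 0 \<le> \<alpha> then cls (dilate \<alpha> A) 0 else cls 0 (dilate (- \<alpha>) A))) \<or>
     (X = cls 0 A \<and> Y = (if 0 \<le> \<alpha> then cls 0 (dilate \<alpha> A) else cls (dilate (- \<alpha>) A) 0)))"

instance ..

end

definition len :: "genint \<Rightarrow> real"
  where "len X = (THE r. \<exists>A. (X = cls A 0 \<or> X = cls 0 A) \<and> r = width A)"

definition cen :: "genint \<Rightarrow> real"
  where "cen X = (THE r. \<exists>A. (X = cls A 0 \<and> r = center A) \<or> (X = cls 0 A \<and> r = - center A))"

lemma cls_pos_eq_iff: "cls A 0 = cls B 0 \<longleftrightarrow> A = B"
  and cls_neg_eq_iff: "cls 0 A = cls 0 B \<longleftrightarrow> A = B"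
  by (auto simp: cls_eq_iff_bounds interval_eq_iff)

lemma cls_pos_eq_neg_iff:
  "cls A 0 = cls 0 B \<longleftrightarrow> (\<exists>a. A = interval_of a \<and> B = interval_of (- a))"
proof
  assume "cls A 0 = cls 0 B"
  then have eq: "lower A + lower B = 0" "upper A + upper B = 0"
    by (simp_all add: cls_eq_iff_bounds)
  with lower_le_upper[of A] lower_le_upper[of B]
  have "upper A = lower A" "lower B = - lower A" "upper B = - lower A" by linarith+
  then show "\<exists>a. A = interval_of a \<and> B = interval_of (- a)"
    by (intro exI[of _ "lower A"]) (simp add: interval_eq_iff)
qed (auto simp: cls_eq_iff_bounds)

lemma cls_neg_eq_pos_iff:
  "cls 0 A = cls B 0 \<longleftrightarrow> (\<exists>a. A = interval_of (- a) \<and> B = interval_of a)"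
  using cls_pos_eq_neg_iff[of B A] by (auto simp: eq_commute[of "cls 0 A"])

lemma scaleR_cls_pos:
  "\<alpha> *\<^sub>R cls A 0 = (if 0 \<le> \<alpha> then cls (dilate \<alpha> A) 0 else cls 0 (dilate (- \<alpha>) A))"
  unfolding scaleR_genint_def
  by (rule the_equality)
    (auto simp: cls_pos_eq_iff dest!: cls_pos_eq_neg_iff[THEN iffD1]; simp add: cls_eq_iff_bounds)+

lemma scaleR_cls_neg:
  "\<alpha> *\<^sub>R cls 0 A = (if 0 \<le> \<alpha> then cls 0 (dilate \<alpha> A) else cls (dilate (- \<alpha>) A) 0)"
  unfolding scaleR_genint_def
  by (rule the_equality)
    (auto simp: cls_neg_eq_iff dest!: cls_neg_eq_pos_iff[THEN iffD1]; simp add: cls_eq_iff_bounds)+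

lemma len_cls_pos: "len (cls A 0) = width A"
  and len_cls_neg: "len (cls 0 A) = width A"
  unfolding len_def
  by (rule the_equality;
      auto simp: cls_pos_eq_iff cls_neg_eq_iff cls_pos_eq_neg_iff
        cls_neg_eq_pos_iff width_def)+

lemma cen_cls_pos: "cen (cls A 0) = center A"
  and cen_cls_neg: "cen (cls 0 A) = - center A"
  unfolding cen_def
  by (rule the_equality;
      auto simp: cls_pos_eq_iff cls_neg_eq_iff cls_pos_eq_neg_iff
        cls_neg_eq_pos_iff center_def)+

lemma scaleR_cls:
  "\<alpha> *\<^sub>R cls x y =
    (if 0 \<le> \<alpha> then cls (dilate \<alpha> x) (dilate \<alpha> y) else cls (dilate (- \<alpha>) y) (dilate (- \<alpha>) x))"
proof (cases "cls x y" rule: genint_cases)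
  case (pos A)
  then have "lower x = lower y + lower A" "upper x = upper y + upper A"
    by (simp_all add: cls_eq_iff_bounds)
  then show ?thesis
    unfolding pos scaleR_cls_pos by (auto simp: cls_eq_iff_bounds algebra_simps)
next
  case (neg A)
  then have "lower y = lower x + lower A" "upper y = upper x + upper A"
    by (simp_all add: cls_eq_iff_bounds)
  then show ?thesis
    unfolding neg scaleR_cls_neg by (auto simp: cls_eq_iff_bounds algebra_simps)
qed

instance genint :: real_vector
proof
  fix a b :: real and X Y :: genint
  obtain x y z t where XY: "X = cls x y" "Y = cls z t"
    by (metis cls_exhaust)
  show "a *\<^sub>R (X + Y) = a *\<^sub>R X + a *\<^sub>R Y"
    by (simp add: XY plus_cls scaleR_cls cls_eq_iff_bounds algebra_simps)
  show "(a + b) *\<^sub>R X = a *\<^sub>R X + b *\<^sub>R X"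
    by (simp add: XY plus_cls scaleR_cls cls_eq_iff_bounds algebra_simps)
  show "a *\<^sub>R b *\<^sub>R X = (a * b) *\<^sub>R X"
  proof -
    consider "a = 0" | "b = 0" | "0 < a" "0 < b" | "0 < a" "b < 0" | "a < 0" "0 < b" | "a < 0" "b < 0"
      by linarith
    then show ?thesis
      by cases (simp_all add: XY scaleR_cls cls_eq_iff_bounds zero_le_mult_iff mult_le_0_iff mult.assoc)
  qed
  show "1 *\<^sub>R X = X"
    by (simp add: XY scaleR_cls cls_eq_iff_bounds)
qed


definition is_norm :: "('a::real_vector \<Rightarrow> real) \<Rightarrow> bool" where
  "is_norm N \<longleftrightarrow>
    (\<forall>X. 0 \<le> N X) \<and>
    (\<forall>X. N X = 0 \<longleftrightarrow> X = 0) \<and>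
    (\<forall>\<alpha> X. N (\<alpha> *\<^sub>R X) = \<bar>\<alpha>\<bar> * N X) \<and>
    (\<forall>X Y. N (X + Y) \<le> N X + N Y)"

end

theory Submission
  imports Defs
begin

text \<open>Up to equivalence, a pair of intervals \<open>(x, y)\<close> stands for the difference of \<open>x\<close> and \<open>y\<close>.
  Center and width are additive on intervals, so the center extends linearly to the quotient, and
  the width extends to the signed width \<open>width x - width y\<close>. The length, although defined by cases
  on the representatives \<open>(A, 0)\<close> and \<open>(0, A)\<close>, is the absolute value of this signed width: the
  sign tells the two kinds of representatives apart. Hence the function in question is the
  \<open>\<ell>\<^sup>1\<close> norm of \<open>\<real>\<^sup>2\<close> in the coordinates signed width and center. Homogeneity and the triangle
  inequality are those of the absolute value, and definiteness holds because the two coordinates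
  together determine both endpoints, hence the class.\<close>

text \<open>With \<open>x = y + A\<close> the signed width is \<open>width A\<close>, with \<open>y = x + A\<close> it is \<open>- width A\<close>. This and
  the analogous formula for the center make it unnecessary to know which kind of representative
  a sum of two classes has.\<close>

lemma len_cls: "len (cls x y) = \<bar>width x - width y\<bar>"
proof (cases "cls x y" rule: genint_cases)
  case (pos A)
  then have "lower x = lower y + lower A" "upper x = upper y + upper A"
    by (simp_all add: cls_eq_iff_bounds)
  then show ?thesis
    unfolding pos len_cls_pos using lower_le_upper[of A] by (simp add: width_def)
next
  case (neg A)
  then have "lower y = lower x + lower A" "upper y = upper x + upper A"
    by (simp_all add: cls_eq_iff_bounds)
  then show ?thesis
    unfolding neg len_cls_neg using lower_le_upper[of A] by (simp add: width_def)
qed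

lemma cen_cls: "cen (cls x y) = center x - center y"
proof (cases "cls x y" rule: genint_cases)
  case (pos A)
  then have "lower x = lower y + lower A" "upper x = upper y + upper A"
    by (simp_all add: cls_eq_iff_bounds)
  then show ?thesis
    unfolding pos cen_cls_pos by (simp add: center_def field_simps)
next
  case (neg A)
  then have "lower y = lower x + lower A" "upper y = upper x + upper A"
    by (simp_all add: cls_eq_iff_bounds)
  then show ?thesis
    unfolding neg cen_cls_neg by (simp add: center_def field_simps)
qed

lemma len_scaleR: "len (\<alpha> *\<^sub>R X) = \<bar>\<alpha>\<bar> * len X"
proof -
  obtain x y where X: "X = cls x y" by (rule cls_exhaust)
  \<comment> \<open>A negative factor swaps the two components as well as dilating them; both cases multiply the
    signed width by \<open>\<alpha>\<close>.\<close>
  have "len (\<alpha> *\<^sub>R X) = \<bar>\<alpha> * (width x - width y)\<bar>"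
    by (simp add: X scaleR_cls len_cls width_def algebra_simps)
  then show ?thesis by (simp add: X len_cls abs_mult)
qed

lemma cen_scaleR: "cen (\<alpha> *\<^sub>R X) = \<alpha> * cen X"
proof -
  obtain x y where X: "X = cls x y" by (rule cls_exhaust)
  show ?thesis by (simp add: X scaleR_cls cen_cls center_def field_simps)
qed

lemma len_triangle: "len (X + Y) \<le> len X + len Y"
proof -
  obtain x y z t where XY: "X = cls x y" "Y = cls z t" by (metis cls_exhaust)
  show ?thesis by (simp add: XY plus_cls len_cls width_def)
qed

lemma cen_add: "cen (X + Y) = cen X + cen Y"
proof -
  obtain x y z t where XY: "X = cls x y" "Y = cls z t" by (metis cls_exhaust)
  show ?thesis by (simp add: XY plus_cls cen_cls center_def field_simps)
qed

lemma len_nonneg: "0 \<le> len X"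
  by (rule cls_exhaust[of X]) (simp add: len_cls)

lemma len_cen_eq_0_iff: "len X = 0 \<and> cen X = 0 \<longleftrightarrow> X = 0"
proof -
  obtain x y where X: "X = cls x y" by (rule cls_exhaust)
  show ?thesis
    by (auto simp: X zero_genint_cls len_cls cen_cls cls_eq_iff_bounds width_def center_def)
qed

theorem theorem11:
  shows "is_norm (\<lambda>X :: genint. len X + \<bar>cen X\<bar>)"
  unfolding is_norm_def
proof (intro conjI allI)
  fix X Y :: genint and \<alpha> :: real
  show "0 \<le> len X + \<bar>cen X\<bar>"
    using len_nonneg[of X] by simp
  show "len X + \<bar>cen X\<bar> = 0 \<longleftrightarrow> X = 0"
    using len_nonneg[of X] len_cen_eq_0_iff[of X] by linarith
  show "len (\<alpha> *\<^sub>R X) + \<bar>cen (\<alpha> *\<^sub>R X)\<bar> = \<bar>\<alpha>\<bar> * (len X + \<bar>cen X\<bar>)"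
    by (simp add: len_scaleR cen_scaleR abs_mult distrib_left)
  show "len (X + Y) + \<bar>cen (X + Y)\<bar> \<le> len X + \<bar>cen X\<bar> + (len Y + \<bar>cen Y\<bar>)"
    using len_triangle[of X Y] by (simp add: cen_add)
qed

end
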